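(* Let $K=M$ (all $M$ gNBs are allowed to be turned off). For any cell in the cluster: (1) if the optimal policy instructs the gNB of the cell to turn off, the action of the greedy policy for that gNB (in the same state) is also OFF; (2) if the greedy policy instructs the gNB to turn on, the optimal action for that gNB (in the same state) is also ON.
   Context: Model. There are $M$ cells, each with a base station (gNB) that is ON ($1$) or OFF ($0$) in each time segment $t$ of duration $T_s>0$. At most $K$ gNBs, $0\le K\le M$, may be OFF in a segment; users of a cell whose gNB is OFF are served by a macro base station (ng-eNB). Constants: $\mathcal P_{\rm static}$ (static power of a gNB that is ON), $\mathcal P_{\rm switch}$ (power for switching a gNB from OFF to ON), $\mathcal P_d$ and $\mathcal P_e$ (average power of a gNB, respectively of the ng-eNB, to serve one user), all non-negative, with $\mathcal P_d<\mathcal P_e$; user arrival rates $\lambda_1,\dots,\lambda_J$; for each cell $m$ a probability vector $(p_{m,1},\dots,p_{m,J})$ and a parameter $\mu_m>0$ of the exponentially distributed staying time of a user; $\overline\lambda_m=\sum_{j=1}^Jp_{m,j}\lambda_j$, so that $\overline\lambda_mT_s$ is the expected number of new arrivals in cell $m$ in one segment. The state at the start of segment $t$ is $\bm s^t=(s_1^t,\dots,s_M^t)$ with $s_m^t=(a_m^{t-1},\widetilde n_m^t)$, where $a_m^{t-1}\in\{0,1\}$ is the status of gNB $m$ in segment $t-1$ and $\widetilde n_m^t\in\{0,1,2,\dots\}$ is the number of users in cell $m$ at the start of segment $t$. The action is $\bm a^t=(a_1^t,\dots,a_M^t)\in\{0,1\}^M$ with $\sum_m a_m^t\ge M-K$,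 where $a_m^t$ is the status of gNB $m$ in segment $t$. When action $\bm a$ is taken in a state $\bm s$, the next state $\bm s'$ has $s'_m=(a_m,\widetilde n'_m)$, where the $\widetilde n'_m$ are independent over $m$ and, whatever $\bm s$ and $\bm a$, $$\Pr(\widetilde n'_m=\ell)=\sum_{j=1}^Jp_{m,j}\frac{\widetilde\lambda_{m,j}^{\ell}}{\ell!}e^{-\widetilde\lambda_{m,j}},\quad \widetilde\lambda_{m,j}=\frac{\lambda_j}{\mu_m}(1-e^{-\mu_mT_s}),\quad \ell=0,1,2,\dots$$ Cost. Let $f$ be a non-decreasing function. The immediate cost of cell $m$ is $c(s_m^t,a_m^t)=f[\mathcal P(s_m^t,a_m^t)]$, where $$\mathcal P\big((a_m^{t-1},\widetilde n_m^t),a_m^t\big)=\begin{cases}\mathcal P_{\rm static}+(\widetilde n_m^t+\overline\lambda_mT_s)\mathcal P_d,&a_m^t=a_m^{t-1}=1,\\ \mathcal P_{\rm static}+\mathcal P_{\rm switch}+(\widetilde n_m^t+\overline\lambda_mT_s)\mathcal P_d,&a_m^t=1,\ a_m^{t-1}=0,\\(\widetilde n_m^t+\overline\lambda_mT_s)\mathcal P_e,&a_m^t=0,\end{cases}$$ and $C(\bm s^t,\bm a^t)=\sum_{m=1}^Mc(s_m^t,a_m^t)$. Optimal policy. A policy $\pi$ maps states to admissible actions; the optimal policy $\pi^*$ minimizes the long-term average cost $\lim_{T\to\infty}\mathbb E\big[\frac1T\sum_{t=0}^{T-1}C(\bm s^t,\bm a^t)\big]$ over policies. It satisfies the Bellman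 equation $$g^*+h_{\pi^*}[\bm s]=\min_{\bm a}\Big\{C(\bm s,\bm a)+\sum_{\bm s'}\Pr(\bm s'\mid\bm s,\bm a)\,h_{\pi^*}[\bm s']\Big\},$$ where $g^*$ is the average cost per time step and $h_{\pi^*}$ the relative value function under $\pi^*$, and $\pi^*(\bm s)$ is an action $\bm a$ attaining this minimum. Greedy policy. The greedy policy $\pi_g$ chooses in every state $\bm s$ an action minimizing the immediate cost $C(\bm s,\bm a)$ over the admissible actions $\bm a$; ties break arbitrarily.
   Formalization: With arbitrary ties the claim fails (e.g. constant f), so (1) and (2) are proved unless ON and OFF are tied for that gNB in that state under both the greedy and the Bellman criterion; they hold everywhere after suitable tie-breaking of either the greedy or the optimal policy. *)

theory Defs
  imports "HOL-Probability.Probability"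
begin

(* Cells are indexed by a finite type 'm (so M = CARD('m)), the possible arrival rates by a finite
   type 'j (so J = CARD('j)).  A gNB status is a bool: True = ON = 1, False = OFF = 0. *)

record ('m, 'j) network =
  max_off  :: nat                    (* K *)
  seg_len  :: real                   (* T_s *)
  P_static :: real
  P_switch :: real
  P_d      :: real
  P_e      :: real
  rate     :: "'j \<Rightarrow> real"            (* lambda_j *)
  mix      :: "'m \<Rightarrow> 'j pmf"          (* the probability vector (p_{m,j})_j *)
  stay     :: "'m \<Rightarrow> real"            (* mu_m *)
  shape    :: "real \<Rightarrow> real"          (* f *)

(* f is only ever applied to powers, which are non-negative. *)
definition valid_network :: "('m::finite, 'j::finite) network \<Rightarrow> bool" where
  "valid_network N \<longleftrightarrow>
     max_off N \<le> CARD('m) \<and> seg_len N > 0 \<and>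
     P_static N \<ge> 0 \<and> P_switch N \<ge> 0 \<and> P_d N \<ge> 0 \<and> P_e N \<ge> 0 \<and> P_d N < P_e N \<and>
     (\<forall>j. rate N j \<ge> 0) \<and> (\<forall>m. stay N m > 0) \<and> mono_on {0..} (shape N)"

(* s m = (status of gNB m in the previous segment, number of users in cell m now) *)
type_synonym 'm state = "'m \<Rightarrow> bool \<times> nat"
type_synonym 'm action = "'m \<Rightarrow> bool"
type_synonym 'm policy = "'m state \<Rightarrow> 'm action"

definition admissible :: "('m::finite, 'j::finite) network \<Rightarrow> 'm action set" where
  "admissible N = {a. card {m. a m} \<ge> CARD('m) - max_off N}"

definition is_policy :: "('m::finite, 'j::finite) network \<Rightarrow> 'm policy \<Rightarrow> bool" where
  "is_policy N \<pi> \<longleftrightarrow> (\<forall>s. \<pi> s \<in> admissible N)"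

definition mean_rate :: "('m::finite, 'j::finite) network \<Rightarrow> 'm \<Rightarrow> real" where
  "mean_rate N m = (\<Sum>j\<in>UNIV. pmf (mix N m) j * rate N j)"

fun cell_power :: "('m::finite, 'j::finite) network \<Rightarrow> 'm \<Rightarrow> bool \<times> nat \<Rightarrow> bool \<Rightarrow> real" where
  "cell_power N m (True,  n) True  =
     P_static N + (real n + mean_rate N m * seg_len N) * P_d N"
| "cell_power N m (False, n) True  =
     P_static N + P_switch N + (real n + mean_rate N m * seg_len N) * P_d N"
| "cell_power N m (_,     n) False =
     (real n + mean_rate N m * seg_len N) * P_e N"

definition cell_cost :: "('m::finite, 'j::finite) network \<Rightarrow> 'm \<Rightarrow> bool \<times> nat \<Rightarrow> bool \<Rightarrow> real" where
  "cell_cost N m x b = shape N (cell_power N m x b)"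

definition cost :: "('m::finite, 'j::finite) network \<Rightarrow> 'm state \<Rightarrow> 'm action \<Rightarrow> real" where
  "cost N s a = (\<Sum>m\<in>UNIV. cell_cost N m (s m) (a m))"

(* poisson_pmf is only specified for a positive parameter *)
definition poisson0_pmf :: "real \<Rightarrow> nat pmf" where
  "poisson0_pmf r = (if r > 0 then poisson_pmf r else return_pmf 0)"

definition eff_rate :: "('m::finite, 'j::finite) network \<Rightarrow> 'm \<Rightarrow> 'j \<Rightarrow> real" where
  "eff_rate N m j = rate N j / stay N m * (1 - exp (- (stay N m * seg_len N)))"

definition users_pmf :: "('m::finite, 'j::finite) network \<Rightarrow> 'm \<Rightarrow> nat pmf" where
  "users_pmf N m = bind_pmf (mix N m) (\<lambda>j. poisson0_pmf (eff_rate N m j))"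

(* Pr(. | s, a).  The user counts are independent over the cells, and their law does not
   depend on s or a. *)
definition next_state_pmf ::
    "('m::finite, 'j::finite) network \<Rightarrow> 'm state \<Rightarrow> 'm action \<Rightarrow> 'm state pmf" where
  "next_state_pmf N s a =
     map_pmf (\<lambda>n m. (a m, n m)) (Pi_pmf UNIV 0 (users_pmf N))"

lemma pmf_poisson0:
  "r \<ge> 0 \<Longrightarrow> pmf (poisson0_pmf r) l = r ^ l / fact l * exp (- r)"
  by (cases l) (auto simp: poisson0_pmf_def pmf_return)

lemma eff_rate_nonneg: "valid_network N \<Longrightarrow> eff_rate N m j \<ge> 0"
  by (auto simp: eff_rate_def valid_network_def less_imp_le
      intro!: mult_nonneg_nonneg divide_nonneg_pos)

lemma pmf_users:
  assumes "valid_network N"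
  shows "pmf (users_pmf N m) l =
    (\<Sum>j\<in>UNIV. pmf (mix N m) j * (eff_rate N m j ^ l / fact l * exp (- eff_rate N m j)))"
  unfolding users_pmf_def pmf_bind
  by (subst integral_measure_pmf_real[of UNIV])
     (simp_all add: pmf_poisson0 eff_rate_nonneg[OF assms] mult.commute)

lemma pmf_next_state:
  "pmf (next_state_pmf N s a) s' =
     (if \<forall>m. fst (s' m) = a m then \<Prod>m\<in>UNIV. pmf (users_pmf N m) (snd (s' m)) else 0)"
proof (cases "\<forall>m. fst (s' m) = a m")
  case True
  let ?g = "\<lambda>n m. (a m, n m)"
  have inj: "inj ?g"
    by (auto simp: inj_def fun_eq_iff)
  have s': "s' = ?g (\<lambda>m. snd (s' m))"
    using True by (auto simp: fun_eq_iff prod_eq_iff)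
  have "pmf (next_state_pmf N s a) (?g (\<lambda>m. snd (s' m))) =
      pmf (Pi_pmf UNIV 0 (users_pmf N)) (\<lambda>m. snd (s' m))"
    unfolding next_state_pmf_def by (rule pmf_map_inj'[OF inj])
  then show ?thesis
    using True s' by (simp add: pmf_Pi)
next
  case False
  then have "s' \<notin> set_pmf (next_state_pmf N s a)"
    by (auto simp: next_state_pmf_def)
  then show ?thesis
    using False by (simp only: if_False set_pmf_iff not_not)
qed

(* the law of s^t when policy pi is followed from the initial state s0 *)
primrec state_pmf ::
    "('m::finite, 'j::finite) network \<Rightarrow> 'm policy \<Rightarrow> 'm state \<Rightarrow> nat \<Rightarrow> 'm state pmf" where
  "state_pmf N \<pi> s0 0 = return_pmf s0"
| "state_pmf N \<pi> s0 (Suc t) =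
     bind_pmf (state_pmf N \<pi> s0 t) (\<lambda>s. next_state_pmf N s (\<pi> s))"

(* The long-term average cost of pi from s0 exists as a real number and equals g.  Costs are
   bounded below (by f(0) in each cell), so a non-integrable cost means an infinite one. *)
definition has_average_cost ::
    "('m::finite, 'j::finite) network \<Rightarrow> 'm policy \<Rightarrow> 'm state \<Rightarrow> real \<Rightarrow> bool" where
  "has_average_cost N \<pi> s0 g \<longleftrightarrow>
     (\<forall>t. integrable (measure_pmf (state_pmf N \<pi> s0 t)) (\<lambda>s. cost N s (\<pi> s))) \<and>
     (\<lambda>T. (\<Sum>t<T. measure_pmf.expectation (state_pmf N \<pi> s0 t) (\<lambda>s. cost N s (\<pi> s))) / real T)
       \<longlonglongrightarrow> g"

definition bellman_value ::
    "('m::finite, 'j::finite) network \<Rightarrow> ('m state \<Rightarrow> real) \<Rightarrow> 'm state \<Rightarrow> 'm action \<Rightarrow> real" where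
  "bellman_value N h s a = cost N s a + measure_pmf.expectation (next_state_pmf N s a) h"

(* The integrability condition says that the series in the Bellman equation converge absolutely;
   without it the library would give a divergent one the value 0. *)
definition bellman_equation ::
    "('m::finite, 'j::finite) network \<Rightarrow> real \<Rightarrow> ('m state \<Rightarrow> real) \<Rightarrow> bool" where
  "bellman_equation N g h \<longleftrightarrow>
     (\<forall>s. \<forall>a\<in>admissible N. integrable (measure_pmf (next_state_pmf N s a)) h) \<and>
     (\<forall>s. g + h s = Min (bellman_value N h s ` admissible N))"

definition bellman_action ::
    "('m::finite, 'j::finite) network \<Rightarrow> ('m state \<Rightarrow> real) \<Rightarrow> 'm state \<Rightarrow> 'm action \<Rightarrow> bool" where
  "bellman_action N h s a \<longleftrightarrow> is_arg_min (bellman_value N h s) (\<lambda>a. a \<in> admissible N) a"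

(* pi is an optimal policy with average cost g and relative value function h.  Minimality of the
   average cost alone would leave pi unconstrained in states that are never visited; the optimal
   action is the one attaining the minimum in the Bellman equation, in every state. *)
definition optimal_policy ::
    "('m::finite, 'j::finite) network \<Rightarrow> real \<Rightarrow> ('m state \<Rightarrow> real) \<Rightarrow> 'm policy \<Rightarrow> bool" where
  "optimal_policy N g h \<pi> \<longleftrightarrow>
     is_policy N \<pi> \<and>
     (\<forall>s0. has_average_cost N \<pi> s0 g) \<and>
     (\<forall>\<pi>' s0 g'. is_policy N \<pi>' \<longrightarrow> has_average_cost N \<pi>' s0 g' \<longrightarrow> g \<le> g') \<and>
     bellman_equation N g h \<and>
     (\<forall>s. bellman_action N h s (\<pi> s))"

definition greedy_action ::
    "('m::finite, 'j::finite) network \<Rightarrow> 'm state \<Rightarrow> 'm action \<Rightarrow> bool" where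
  "greedy_action N s a \<longleftrightarrow> is_arg_min (cost N s) (\<lambda>a. a \<in> admissible N) a"

definition greedy_policy :: "('m::finite, 'j::finite) network \<Rightarrow> 'm policy \<Rightarrow> bool" where
  "greedy_policy N \<pi> \<longleftrightarrow> (\<forall>s. greedy_action N s (\<pi> s))"

(* Among the minimizing actions (those satisfying A), some have gNB m ON and some have it OFF.
   When this happens for both the greedy and the Bellman criterion (e.g. for constant f), two
   policies that break the ties independently can differ arbitrarily at gNB m. *)
definition tied :: "('m action \<Rightarrow> bool) \<Rightarrow> 'm \<Rightarrow> bool" where
  "tied A m \<longleftrightarrow> (\<exists>a. A a \<and> a m) \<and> (\<exists>a. A a \<and> \<not> a m)"

end

theory Submission
  imports Defs
begin

text \<open>
  With every action admissible, the immediate cost is minimized cell by cell.  The law of the next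
  user counts depends on neither state nor action, so the Bellman value of an action a is its
  immediate cost plus a number H a.  Having been ON before never costs more than having been OFF,
  hence h, and with it H, can only decrease when more gNBs are ON.  So when the optimal action
  leaves a gNB OFF, this cannot be because of H: OFF is also at least as cheap immediately.

  For the last claim, the modified policy still attains the minimum in the Bellman equation;
  telescoping that equation, with the expectation of h bounded uniformly in time, shows that it has
  the same average cost.
\<close>

section \<open>Integration against a mixture of discrete laws\<close>

lemma has_bochner_integral_bind_pmf_nonneg:
  fixes f :: "'b \<Rightarrow> real" and K :: "'a \<Rightarrow> 'b pmf"
  assumes nonneg: "\<And>y. 0 \<le> f y"
    and int: "\<And>x. integrable (measure_pmf (K x)) f"
    and bound: "\<And>x. measure_pmf.expectation (K x) f \<le> B"
  shows "has_bochner_integral (measure_pmf (bind_pmf p K)) f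
    (measure_pmf.expectation p (\<lambda>x. measure_pmf.expectation (K x) f))"
proof -
  let ?F = "\<lambda>x. measure_pmf.expectation (K x) f"
  have F: "0 \<le> ?F x" for x
    by (simp add: nonneg)
  \<comment> \<open>The uniform bound \<open>B\<close> makes the inner expectations integrable under
    any \<open>p\<close>, so the iterated integral below is finite.\<close>
  have F_int: "integrable (measure_pmf p) ?F"
    by (rule measure_pmf.integrable_const_bound[where B = B]) (use F bound in auto)
  have "(\<integral>\<^sup>+ y. ennreal (f y) \<partial>bind_pmf p K) = (\<integral>\<^sup>+ x. ennreal (?F x) \<partial>p)"
    by (simp add: nn_integral_eq_integral[OF int] nonneg)
  also have "\<dots> = ennreal (measure_pmf.expectation p ?F)"
    by (rule nn_integral_eq_integral[OF F_int]) (use F in auto)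
  finally show ?thesis
    by (intro has_bochner_integral_nn_integral) (auto simp: nonneg F)
qed

text \<open>Positive and negative parts of \<open>f\<close> are treated separately; each is
  dominated by the absolute value of \<open>f\<close>, so the same \<open>B\<close> bounds
  both.\<close>

lemma has_bochner_integral_bind_pmf:
  fixes f :: "'b \<Rightarrow> real" and K :: "'a \<Rightarrow> 'b pmf"
  assumes int: "\<And>x. integrable (measure_pmf (K x)) f"
    and bound: "\<And>x. measure_pmf.expectation (K x) (\<lambda>y. \<bar>f y\<bar>) \<le> B"
  shows "has_bochner_integral (measure_pmf (bind_pmf p K)) f
    (measure_pmf.expectation p (\<lambda>x. measure_pmf.expectation (K x) f))"
proof -
  let ?E = "\<lambda>x u. measure_pmf.expectation (K x) u"
  let ?p = "\<lambda>y. max (f y) 0" and ?n = "\<lambda>y. max (- f y) 0"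
  have ints: "integrable (measure_pmf (K x)) ?p" "integrable (measure_pmf (K x)) ?n" for x
    using int by auto
  have "?E x ?p \<le> ?E x (\<lambda>y. \<bar>f y\<bar>)" "?E x ?n \<le> ?E x (\<lambda>y. \<bar>f y\<bar>)" for x
    using int ints by (auto intro!: integral_mono)
  then have bounds: "?E x ?p \<le> B" "?E x ?n \<le> B" for x
    using bound order_trans by blast+
  have "0 \<le> ?E x ?p" "0 \<le> ?E x ?n" for x
    by (auto intro!: integral_nonneg)
  then have outer: "integrable (measure_pmf p) (\<lambda>x. ?E x ?p)" "integrable (measure_pmf p) (\<lambda>x. ?E x ?n)"
    using bounds by (auto intro!: measure_pmf.integrable_const_bound[where B = B])
  have split: "?p y - ?n y = f y" for y
    by (simp add: max_def)
  have "?E x ?p - ?E x ?n = ?E x f" for x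
    using Bochner_Integration.integral_diff[OF ints[of x]] by (simp only: split)
  then have "measure_pmf.expectation p (\<lambda>x. ?E x ?p) - measure_pmf.expectation p (\<lambda>x. ?E x ?n) =
      measure_pmf.expectation p (\<lambda>x. ?E x f)"
    using Bochner_Integration.integral_diff[OF outer] by simp
  moreover have "has_bochner_integral (measure_pmf (bind_pmf p K)) (\<lambda>y. ?p y - ?n y)
      (measure_pmf.expectation p (\<lambda>x. ?E x ?p) - measure_pmf.expectation p (\<lambda>x. ?E x ?n))"
    by (intro has_bochner_integral_diff has_bochner_integral_bind_pmf_nonneg[where B = B] ints bounds) auto
  ultimately show ?thesis
    by (simp only: split)
qed

section \<open>Immediate costs\<close>

lemma admissible_eq_UNIV:
  fixes N :: "('m::finite, 'j::finite) network"
  assumes "max_off N = CARD('m)"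
  shows "admissible N = UNIV"
  using assms by (simp add: admissible_def)

lemma cell_cost_prev_on_le:
  assumes "valid_network N"
  shows "cell_cost N m (True, n) b \<le> cell_cost N m (False, n) b"
proof (cases b)
  case True
  have mean: "0 \<le> mean_rate N m"
    using assms unfolding mean_rate_def valid_network_def
    by (intro sum_nonneg mult_nonneg_nonneg) auto
  \<comment> \<open>\<open>shape N\<close> is monotone only on \<open>{0..}\<close>, so the smaller
    power must be shown to lie there.\<close>
  have "0 \<le> cell_power N m (True, n) True"
    "cell_power N m (True, n) True \<le> cell_power N m (False, n) True"
    using assms mean by (auto simp: valid_network_def)
  then show ?thesis
    using assms True unfolding cell_cost_def valid_network_def
    by (auto intro!: mono_onD[where f = "shape N"] simp del: cell_power.simps)
next
  case False
  then show ?thesis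
    by (simp add: cell_cost_def)
qed

lemma cost_upd_le_iff:
  fixes a :: "'m::finite action"
  shows "cost N s (a(m := b)) \<le> cost N s a \<longleftrightarrow> cell_cost N m (s m) b \<le> cell_cost N m (s m) (a m)"
proof -
  have "cost N s a' = cell_cost N m (s m) (a' m) + (\<Sum>i\<in>UNIV - {m}. cell_cost N i (s i) (a' i))"
    for a'
    unfolding cost_def by (rule sum.remove) auto
  moreover have "(\<Sum>i\<in>UNIV - {m}. cell_cost N i (s i) ((a(m := b)) i)) =
      (\<Sum>i\<in>UNIV - {m}. cell_cost N i (s i) (a i))"
    by (rule sum.cong) auto
  ultimately show ?thesis
    by simp
qed

section \<open>The Bellman equation when every action is admissible\<close>

locale all_off_network =
  fixes N :: "('m::finite, 'j::finite) network" and g :: real and h :: "'m state \<Rightarrow> real"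
  assumes valid: "valid_network N"
    and max_off: "max_off N = CARD('m)"
    and bellman: "bellman_equation N g h"
begin

text \<open>This is the H of the overview; the state drops out because the law of the next user
  counts ignores it.\<close>

definition next_value :: "'m action \<Rightarrow> real" where
  "next_value a = measure_pmf.expectation (Pi_pmf UNIV 0 (users_pmf N)) (\<lambda>n. h (\<lambda>m. (a m, n m)))"

lemma greedy_action_iff: "greedy_action N s a \<longleftrightarrow> (\<forall>b. cost N s a \<le> cost N s b)"
  by (simp add: greedy_action_def admissible_eq_UNIV[OF max_off] is_arg_min_linorder)

lemma bellman_action_iff:
  "bellman_action N h s a \<longleftrightarrow> (\<forall>b. bellman_value N h s a \<le> bellman_value N h s b)"
  by (simp add: bellman_action_def admissible_eq_UNIV[OF max_off] is_arg_min_linorder)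

text \<open>The action \<open>a(m := b)\<close> is an admissible competitor of \<open>a\<close>, and
  updating it back to \<open>a m\<close> isolates the cost of cell \<open>m\<close>.\<close>

lemma greedy_action_cell:
  "greedy_action N s a \<Longrightarrow> cell_cost N m (s m) (a m) \<le> cell_cost N m (s m) b"
  using cost_upd_le_iff[of N s a m b] cost_upd_le_iff[of N s "a(m := b)" m "a m"]
  by (auto simp: greedy_action_iff)

lemma greedy_action_iff_cells:
  "greedy_action N s a \<longleftrightarrow> (\<forall>m b. cell_cost N m (s m) (a m) \<le> cell_cost N m (s m) b)"
proof
  assume "\<forall>m b. cell_cost N m (s m) (a m) \<le> cell_cost N m (s m) b"
  then show "greedy_action N s a"
    by (auto simp: greedy_action_iff cost_def intro!: sum_mono)
qed (auto intro: greedy_action_cell)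

lemma bellman_value_eq: "bellman_value N h s a = cost N s a + next_value a"
  by (simp add: bellman_value_def next_value_def next_state_pmf_def)

lemma integrable_next_state: "integrable (measure_pmf (next_state_pmf N s a)) h"
  using bellman by (auto simp: bellman_equation_def admissible_eq_UNIV[OF max_off])

lemma integrable_next_value:
  "integrable (measure_pmf (Pi_pmf UNIV 0 (users_pmf N))) (\<lambda>n. h (\<lambda>m. (a m, n m)))"
  using integrable_next_state[of undefined a]
  by (simp add: next_state_pmf_def map_pmf_rep_eq integrable_distr_eq)

lemma bellman_le: "g + h s \<le> bellman_value N h s a"
  using bellman unfolding bellman_equation_def admissible_eq_UNIV[OF max_off] by simp

lemma bellman_attained: "\<exists>a. bellman_value N h s a = g + h s"
proof -
  have "g + h s = Min (range (bellman_value N h s))"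
    using bellman by (simp add: bellman_equation_def admissible_eq_UNIV[OF max_off])
  moreover have "Min (range (bellman_value N h s)) \<in> range (bellman_value N h s)"
    by (rule Min_in) auto
  ultimately show ?thesis
    by (metis imageE)
qed

lemma bellman_action_value: "bellman_action N h s a \<Longrightarrow> bellman_value N h s a = g + h s"
  using bellman_attained[of s] bellman_le[of s a] by (metis antisym bellman_action_iff)

text \<open>An action \<open>c\<close> that is optimal from the state with fewer gNBs ON is tried
  from the other state: the continuation \<open>next_value c\<close> stays the same and only the
  immediate cost can drop.\<close>

lemma relative_value_antimono:
  assumes "\<And>m. a m \<Longrightarrow> b m"
  shows "h (\<lambda>m. (b m, n m)) \<le> h (\<lambda>m. (a m, n m))"
proof -
  let ?a = "\<lambda>m. (a m, n m)" and ?b = "\<lambda>m. (b m, n m)"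
  obtain c where c: "bellman_value N h ?a c = g + h ?a"
    using bellman_attained by blast
  have "cost N ?b c \<le> cost N ?a c"
    unfolding cost_def
  proof (rule sum_mono)
    fix m
    show "cell_cost N m (b m, n m) (c m) \<le> cell_cost N m (a m, n m) (c m)"
      using assms[of m] cell_cost_prev_on_le[OF valid, of m "n m" "c m"]
      by (cases "a m"; cases "b m") auto
  qed
  moreover have "g + h ?b \<le> cost N ?b c + next_value c"
    using bellman_le bellman_value_eq by simp
  moreover have "cost N ?a c + next_value c = g + h ?a"
    using c bellman_value_eq by simp
  ultimately show ?thesis
    by linarith
qed

lemma next_value_antimono: "(\<And>m. a m \<Longrightarrow> b m) \<Longrightarrow> next_value b \<le> next_value a"
  unfolding next_value_def
  by (intro integral_mono integrable_next_value relative_value_antimono)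

section \<open>Greedy against Bellman actions\<close>

lemma bellman_off_imp_cost_off_le:
  assumes "bellman_action N h s a" "\<not> a m"
  shows "cell_cost N m (s m) False \<le> cell_cost N m (s m) True"
proof -
  have "next_value (a(m := True)) \<le> next_value a"
    by (rule next_value_antimono) auto
  moreover have "bellman_value N h s a \<le> bellman_value N h s (a(m := True))"
    using assms by (simp add: bellman_action_iff)
  ultimately have "cost N s a \<le> cost N s (a(m := True))"
    by (simp add: bellman_value_eq)
  then show ?thesis
    \<comment> \<open>As \<open>a\<close> has \<open>m\<close> OFF, it is itself the update of
      \<open>a(m := True)\<close> by \<open>False\<close>.\<close>
    using cost_upd_le_iff[of N s "a(m := True)" m False] assms(2) by (simp add: fun_upd_idem)
qed

text \<open>The action differs from \<open>b\<close> only at cells that are ON in \<open>b\<close>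
  and OFF in \<open>a\<close>; there OFF costs no more than ON, so each cell cost stays
  minimal.\<close>

lemma greedy_action_inf:
  assumes "greedy_action N s b" "bellman_action N h s a"
  shows "greedy_action N s (\<lambda>m. b m \<and> a m)"
  unfolding greedy_action_iff_cells
proof (intro allI)
  fix m c
  show "cell_cost N m (s m) (b m \<and> a m) \<le> cell_cost N m (s m) c"
    using greedy_action_cell[OF assms(1), of m c] bellman_off_imp_cost_off_le[OF assms(2), of m]
    by (cases "a m"; cases "b m") auto
qed

text \<open>The cells changed in \<open>a\<close> receive the greedy choice, so the immediate cost
  does not rise; more gNBs are ON, so \<open>next_value\<close> does not rise either.\<close>

lemma bellman_action_sup:
  assumes "greedy_action N s b" "bellman_action N h s a"
  shows "bellman_action N h s (\<lambda>m. a m \<or> b m)"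
proof -
  have "cost N s (\<lambda>m. a m \<or> b m) \<le> cost N s a"
    unfolding cost_def
  proof (rule sum_mono)
    fix m
    show "cell_cost N m (s m) (a m \<or> b m) \<le> cell_cost N m (s m) (a m)"
      using greedy_action_cell[OF assms(1), of m "a m"] by (cases "a m"; cases "b m") auto
  qed
  moreover have "next_value (\<lambda>m. a m \<or> b m) \<le> next_value a"
    by (rule next_value_antimono) auto
  ultimately have "bellman_value N h s (\<lambda>m. a m \<or> b m) \<le> bellman_value N h s a"
    by (simp add: bellman_value_eq)
  then show ?thesis
    using assms(2) unfolding bellman_action_iff by (meson order_trans)
qed

text \<open>The greedy actions \<open>b\<close> and its meet with \<open>a\<close> differ at
  \<open>m\<close>, and so do the Bellman actions \<open>a\<close> and its join with
  \<open>b\<close>.\<close>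

lemma tied_if_disagree:
  assumes "greedy_action N s b" "bellman_action N h s a" "b m" "\<not> a m"
  shows "tied (greedy_action N s) m \<and> tied (bellman_action N h s) m"
  unfolding tied_def
  using assms greedy_action_inf[OF assms(1,2)] bellman_action_sup[OF assms(1,2)] by metis

text \<open>Integrating h after a step costs at most a constant, whatever the action, because there are
  only finitely many actions and the user counts always have the same law.\<close>

definition value_bound :: real where
  "value_bound = (\<Sum>a\<in>UNIV. measure_pmf.expectation (Pi_pmf UNIV 0 (users_pmf N))
     (\<lambda>n. \<bar>h (\<lambda>m. (a m, n m))\<bar>))"

lemma expectation_abs_next_state_le:
  "measure_pmf.expectation (next_state_pmf N s a) (\<lambda>s'. \<bar>h s'\<bar>) \<le> value_bound"
proof -
  let ?E = "\<lambda>a. measure_pmf.expectation (Pi_pmf UNIV 0 (users_pmf N)) (\<lambda>n. \<bar>h (\<lambda>m. (a m, n m))\<bar>)"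
  have "?E a \<le> (\<Sum>a\<in>UNIV. ?E a)"
    by (rule member_le_sum) auto
  then show ?thesis
    by (simp add: value_bound_def next_state_pmf_def)
qed

lemma expectation_next_state: "measure_pmf.expectation (next_state_pmf N s a) h = next_value a"
  by (simp add: next_state_pmf_def next_value_def)

lemma abs_next_value_le: "\<bar>next_value a\<bar> \<le> value_bound"
  using integral_abs_bound[of "measure_pmf (next_state_pmf N undefined a)" h]
    expectation_abs_next_state_le[of undefined a]
  by (simp add: expectation_next_state)

lemma integrable_next_value_policy:
  "integrable (measure_pmf p) (\<lambda>s. next_value (\<pi> s))"
  by (rule measure_pmf.integrable_const_bound[where B = value_bound])
     (use abs_next_value_le in auto)

text \<open>Conditioning on the state before the last step; thanks to \<open>value_bound\<close>,
  integrability of \<open>h\<close> under the law of that state is not presupposed.\<close>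

lemma has_bochner_integral_state_Suc:
  "has_bochner_integral (measure_pmf (state_pmf N \<pi> s0 (Suc t))) h
     (measure_pmf.expectation (state_pmf N \<pi> s0 t) (\<lambda>s. next_value (\<pi> s)))"
  using has_bochner_integral_bind_pmf[OF integrable_next_state expectation_abs_next_state_le]
  by (simp add: expectation_next_state)

lemma integrable_state: "integrable (measure_pmf (state_pmf N \<pi> s0 t)) h"
proof (cases t)
  case 0
  then show ?thesis
    by (simp add: integrable_measure_pmf_finite)
next
  case (Suc t')
  then show ?thesis
    using has_bochner_integral_state_Suc has_bochner_integral_iff by blast
qed

lemma has_average_cost_bellman:
  assumes "\<And>s. bellman_action N h s (\<pi> s)"
  shows "has_average_cost N \<pi> s0 g"
proof -
  let ?p = "state_pmf N \<pi> s0"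
  define e where "e t = measure_pmf.expectation (?p t) h" for t
  \<comment> \<open>The Bellman equation solved for the cost: integrability reduces to that of
    \<open>h\<close> and \<open>next_value\<close>, and expected costs telescope.\<close>
  have cost_eq: "cost N s (\<pi> s) = (g + h s) - next_value (\<pi> s)" for s
    using bellman_action_value[OF assms[of s]] by (simp add: bellman_value_eq)
  have int: "integrable (measure_pmf (?p t)) (\<lambda>s. cost N s (\<pi> s))" for t
    unfolding cost_eq using integrable_state integrable_next_value_policy
    by (intro Bochner_Integration.integrable_diff Bochner_Integration.integrable_add) auto
  have e_Suc: "e (Suc t) = measure_pmf.expectation (?p t) (\<lambda>s. next_value (\<pi> s))" for t
    unfolding e_def using has_bochner_integral_state_Suc by (rule has_bochner_integral_integral_eq)
  have step: "measure_pmf.expectation (?p t) (\<lambda>s. cost N s (\<pi> s)) = g + e t - e (Suc t)" for t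
    unfolding cost_eq e_Suc using integrable_state[of \<pi> s0 t] integrable_next_value_policy[of "?p t" \<pi>]
    by (simp add: e_def)
  have total: "(\<Sum>t<T. measure_pmf.expectation (?p t) (\<lambda>s. cost N s (\<pi> s))) = real T * g + (e 0 - e T)"
    for T
    by (induction T) (simp_all add: step algebra_simps)
  \<comment> \<open>From time 1 on \<open>value_bound\<close> suffices; at time 0 the state is the
    arbitrary \<open>s0\<close>, where \<open>h\<close> may be larger.\<close>
  define B where "B = max \<bar>e 0\<bar> value_bound"
  have e_bound: "\<bar>e t\<bar> \<le> B" for t
  proof (cases t)
    case 0
    then show ?thesis
      by (simp add: B_def)
  next
    case (Suc t')
    have "\<bar>e (Suc t')\<bar> \<le> measure_pmf.expectation (?p t') (\<lambda>s. \<bar>next_value (\<pi> s)\<bar>)"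
      unfolding e_Suc by (rule integral_abs_bound)
    also have "\<dots> \<le> value_bound"
      by (rule measure_pmf.integral_le_const)
         (use integrable_next_value_policy[of "?p t'" \<pi>] abs_next_value_le in auto)
    finally show ?thesis
      using Suc by (simp add: B_def)
  qed
  have "(\<lambda>T. (e 0 - e T) / real T) \<longlonglongrightarrow> 0"
  proof (rule Lim_null_comparison)
    show "\<forall>\<^sub>F T in sequentially. norm ((e 0 - e T) / real T) \<le> (2 * B) / real T"
    proof (rule always_eventually, rule allI)
      fix T
      have "\<bar>e 0 - e T\<bar> \<le> 2 * B"
        using e_bound[of 0] e_bound[of T] by linarith
      then show "norm ((e 0 - e T) / real T) \<le> (2 * B) / real T"
        by (simp add: divide_right_mono)
    qed
    show "(\<lambda>T. (2 * B) / real T) \<longlonglongrightarrow> 0"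
      by (rule lim_const_over_n)
  qed
  then have "(\<lambda>T. g + (e 0 - e T) / real T) \<longlonglongrightarrow> g"
    using tendsto_add[OF tendsto_const[of g]] by fastforce
  then have "(\<lambda>T. (\<Sum>t<T. measure_pmf.expectation (?p t) (\<lambda>s. cost N s (\<pi> s))) / real T) \<longlonglongrightarrow> g"
  proof (rule Lim_transform_eventually)
    show "\<forall>\<^sub>F T in sequentially. g + (e 0 - e T) / real T =
        (\<Sum>t<T. measure_pmf.expectation (?p t) (\<lambda>s. cost N s (\<pi> s))) / real T"
      \<comment> \<open>At \<open>T = 0\<close> the right side is 0 and the left side is
        \<open>g\<close>, so equality is claimed only for positive \<open>T\<close>.\<close>
      using eventually_gt_at_top[of "0::nat"]
      by eventually_elim (simp add: total add_divide_distrib)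
  qed
  then show ?thesis
    using int by (simp add: has_average_cost_def)
qed

end

theorem proposition4:
  fixes N :: "('m::finite, 'j::finite) network"
    and g :: real and h :: "'m state \<Rightarrow> real"
    and \<pi>opt \<pi>g :: "'m policy"
  assumes "valid_network N"
    and "max_off N = CARD('m)"
    and "optimal_policy N g h \<pi>opt"
    and "greedy_policy N \<pi>g"
  shows "(\<forall>s m. \<not> (tied (greedy_action N s) m \<and> tied (bellman_action N h s) m) \<longrightarrow>
            (\<not> \<pi>opt s m \<longrightarrow> \<not> \<pi>g s m) \<and> (\<pi>g s m \<longrightarrow> \<pi>opt s m)) \<and>
         (\<exists>\<pi>g'. greedy_policy N \<pi>g' \<and>
            (\<forall>s m. (\<not> \<pi>opt s m \<longrightarrow> \<not> \<pi>g' s m) \<and> (\<pi>g' s m \<longrightarrow> \<pi>opt s m))) \<and>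
         (\<exists>\<pi>opt'. optimal_policy N g h \<pi>opt' \<and>
            (\<forall>s m. (\<not> \<pi>opt' s m \<longrightarrow> \<not> \<pi>g s m) \<and> (\<pi>g s m \<longrightarrow> \<pi>opt' s m)))"
proof -
  have bell: "bellman_equation N g h" and opt: "bellman_action N h s (\<pi>opt s)" for s
    using assms(3) by (auto simp: optimal_policy_def)
  interpret all_off_network N g h
    using assms(1,2) bell by unfold_locales
  have greedy: "greedy_action N s (\<pi>g s)" for s
    using assms(4) by (simp add: greedy_policy_def)
  have "greedy_policy N (\<lambda>s m. \<pi>g s m \<and> \<pi>opt s m)"
    unfolding greedy_policy_def using greedy_action_inf[OF greedy opt] by blast
  then have 2: "\<exists>\<pi>g'. greedy_policy N \<pi>g' \<and>
      (\<forall>s m. (\<not> \<pi>opt s m \<longrightarrow> \<not> \<pi>g' s m) \<and> (\<pi>g' s m \<longrightarrow> \<pi>opt s m))"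
    by (intro exI[of _ "\<lambda>s m. \<pi>g s m \<and> \<pi>opt s m"]) auto
  let ?\<pi> = "\<lambda>s m. \<pi>opt s m \<or> \<pi>g s m"
  have sup: "bellman_action N h s (?\<pi> s)" for s
    by (rule bellman_action_sup[OF greedy opt])
  \<comment> \<open>The Bellman equation and the minimality of \<open>g\<close> do not mention the
    policy and carry over; the new obligations are attainment in every state and the average
    cost.\<close>
  have "optimal_policy N g h ?\<pi>"
    using assms(3) sup has_average_cost_bellman[of ?\<pi>, OF sup]
    unfolding optimal_policy_def is_policy_def admissible_eq_UNIV[OF max_off] by blast
  then have 3: "\<exists>\<pi>opt'. optimal_policy N g h \<pi>opt' \<and>
      (\<forall>s m. (\<not> \<pi>opt' s m \<longrightarrow> \<not> \<pi>g s m) \<and> (\<pi>g s m \<longrightarrow> \<pi>opt' s m))"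
    by (intro exI[of _ ?\<pi>]) auto
  show ?thesis
    using tied_if_disagree[OF greedy opt] 2 3 by blast
qed

end
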